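(* Let $\mathcal{X}\subset\mathbb{R}^n$ be a nonempty compact convex set with diameter $d_x$, and let $f:\mathbb{R}^n\to\mathbb{R}$ be differentiable with gradient Lipschitz constant $L_1(f)>0$, i.e. $\|\nabla f(x)-\nabla f(y)\|\le L_1(f)\|x-y\|$ for all $x,y\in\mathbb{R}^n$. Let $x^\ast$ be a minimiser of $f$ over $\mathcal{X}$. Assume that $F=f+\mathcal{I}_{\mathcal{X}}$, where $\mathcal{I}_{\mathcal{X}}$ is the indicator function of $\mathcal{X}$, satisfies the proximal PL condition on $\mathcal{X}$ with constant $l>0$, i.e. $\frac12 Q(x,L_1(f))\ge l\,(F(x)-F(x^\ast))$ for all $x\in\mathcal{X}$. Let $\mu>0$, $x_0\in\mathcal{X}$, and let $\{x_k\}_{k\ge 0}$ be the random sequence generated by $$x_{k+1}=\mathrm{Proj}_{\mathcal{X}}\bigl(x_k-h_k\,g_\mu(x_k)\bigr),\qquad h_k=\frac{1}{L_1(f)},$$ where $g_\mu(x_k)=\frac{f(x_k+\mu u_k)-f(x_k)}{\mu}Bu_k$ is the Gaussian random oracle evaluated with the $k$-th random vector $u_k$. For each $k$ let $\sigma_k\ge 0$ be such that $E_{u_k}[\|g_\mu(x_k)-\nabla f_\mu(x_k)\|^2]\le\sigma_k^2$. Then, for any integer $N\ge 0$, $$\frac{1}{N+1}\sum_{k=0}^{N}\bigl(\Phi_k-f(x^\ast)\bigr)\le \frac{L_1(f)}{l}\,\frac{f(x_0)-f(x^\ast)}{N+1}+\frac{\mu\, d_x L_1(f)^2(n+3)^{3/2}}{2l}+\frac{L_1(f)d_x}{l(N+1)}\sum_{k=0}^{N}\sigma_k+\frac{1}{l(N+1)}\sum_{k=0}^{N}\sigma_k^2,$$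 where $\Phi_0=f(x_0)$ and $\Phi_k=E_{\mathcal{U}_k}[f(x_k)]$ for $k\ge1$, with $\mathcal{U}_k=\{u_0,u_1,\dots,u_{k-1}\}$.
   Context: $\|\cdot\|$ is the Euclidean norm. The indicator function is $\mathcal{I}_{\mathcal{X}}(x)=0$ for $x\in\mathcal{X}$ and $\infty$ for $x\notin\mathcal{X}$. The projection is $\mathrm{Proj}_{\mathcal{X}}(x)=\arg\min_{z\in\mathcal{X}}\|z-x\|^2$. For $a>0$ and $F=f+h$ with $h=\mathcal{I}_{\mathcal{X}}$, $$Q(x,a)=-2a\min_{z\in\mathcal{X}}\Bigl\{\frac a2\|z-x\|^2+\langle\nabla f(x),z-x\rangle+h(z)-h(x)\Bigr\}.$$ The vectors $u_0,u_1,\dots$ are independent zero-mean Gaussian vectors in $\mathbb{R}^n$ with positive definite correlation operator $B^{-1}$, having density $\frac1\kappa e^{-\frac12\|u\|^2}$ with respect to Lebesgue measure, where $\kappa=\int_{\mathbb{R}^n} e^{-\frac12\|u\|^2}\,\mathrm{d}u=\frac{(2\pi)^{n/2}}{(\det B)^{1/2}}$ (with the Euclidean norm these conventions mean that $B$ is the identity matrix). The Gaussian smoothed version of $f$ is $f_\mu(x)=\frac1\kappa\int_{\mathbb{R}^n} f(x+\mu u)e^{-\frac12\|u\|^2}\,\mathrm{d}u$. $E_{u_k}$ denotes expectation over $u_k$ with $u_0,\dots,u_{k-1}$ (hence $x_k$) fixed, and $E_{\mathcal{U}_k}$ denotes expectation over $u_0,\dots,u_{k-1}$. The numbers $\sigma_k$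 are deterministic, the bound defining them holding for (almost) every realisation of $x_k$. *)

theory Defs
  imports "HOL-Probability.Probability"
begin

definition gradient :: "(real^'n \<Rightarrow> real) \<Rightarrow> real^'n \<Rightarrow> real^'n"
  where "gradient f x = (THE D. GDERIV f x :> D)"

lemma gradient_eqI: "GDERIV f x :> D \<Longrightarrow> gradient f x = D"
proof -
  assume D: "GDERIV f x :> D"
  have "E = D" if "GDERIV f x :> E" for E
  proof -
    have "(\<lambda>h. h \<bullet> E) = (\<lambda>h. h \<bullet> D)"
      using that D unfolding gderiv_def by (rule has_derivative_unique)
    then have "h \<bullet> E = h \<bullet> D" for h
      by meson
    then show "E = D"
      by (metis vector_eq_ldot)
  qed
  with D show ?thesis
    unfolding gradient_def by blast
qed

text \<open>The indicator function of convex analysis (the library's \<^const>\<open>indicator\<close> is the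
  0/1-valued one).\<close>

definition convex_indicator :: "'a set \<Rightarrow> 'a \<Rightarrow> ereal"
  where "convex_indicator X x = (if x \<in> X then 0 else \<infinity>)"

text \<open>The minimum over \<open>X\<close> is written as an infimum in the extended reals; for nonempty compact
  \<open>X\<close>, \<open>h = convex_indicator X\<close> and \<open>x \<in> X\<close> it is attained.\<close>

definition prox_Q ::
    "(real^'n \<Rightarrow> real) \<Rightarrow> (real^'n \<Rightarrow> ereal) \<Rightarrow> (real^'n) set \<Rightarrow> real^'n \<Rightarrow> real \<Rightarrow> ereal"
  where "prox_Q f h X x a =
    ereal (- 2 * a) *
      (INF z\<in>X. ereal (a / 2 * (norm (z - x))\<^sup>2 + gradient f x \<bullet> (z - x)) + h z - h x)"

text \<open>The proximal PL condition on \<open>X\<close> with constant \<open>l\<close> for \<open>F = f + convex_indicator X\<close>,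
  where \<open>a\<close> is the Lipschitz constant of the gradient of \<open>f\<close> and \<open>xs\<close> a minimiser of \<open>F\<close>.\<close>

definition proximal_PL ::
    "(real^'n \<Rightarrow> real) \<Rightarrow> (real^'n) set \<Rightarrow> real \<Rightarrow> real \<Rightarrow> real^'n \<Rightarrow> bool"
  where "proximal_PL f X a l xs \<longleftrightarrow>
    (let F = (\<lambda>x. ereal (f x) + convex_indicator X x)
     in \<forall>x\<in>X. ereal (1 / 2) * prox_Q f (convex_indicator X) X x a \<ge> ereal l * (F x - F xs))"

definition gauss_density :: "real^'n \<Rightarrow> real"
  where "gauss_density u =
    exp (- (1 / 2) * (norm u)\<^sup>2) / (\<integral>v. exp (- (1 / 2) * (norm (v :: real^'n))\<^sup>2) \<partial>lborel)"

definition gauss_smooth :: "real \<Rightarrow> (real^'n \<Rightarrow> real) \<Rightarrow> real^'n \<Rightarrow> real"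
  where "gauss_smooth \<mu> f x = (\<integral>u. f (x + \<mu> *\<^sub>R u) * gauss_density u \<partial>lborel)"

text \<open>\<open>B\<close> is the inverse of the correlation operator of the directions \<open>u\<close>; for directions with
  density \<^const>\<open>gauss_density\<close> that is the identity matrix.\<close>

definition gauss_oracle ::
    "real^'n^'n \<Rightarrow> real \<Rightarrow> (real^'n \<Rightarrow> real) \<Rightarrow> real^'n \<Rightarrow> real^'n \<Rightarrow> real^'n"
  where "gauss_oracle B \<mu> f x u = ((f (x + \<mu> *\<^sub>R u) - f x) / \<mu>) *\<^sub>R (B *v u)"

end

theory Submission
  imports Defs
begin

text \<open>The idea is to measure one step of the method against the step that the exact gradient would
  have produced. Write \<open>m g x z = L / 2 * norm (z - x)^2 + g \<bullet> (z - x)\<close>. The projected step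
  \<open>x'\<close> with the estimate \<open>g\<close> minimises \<open>m g x\<close> over \<open>X\<close>, the projected step \<open>y\<close> with
  \<open>gradient f x\<close> minimises \<open>m (gradient f x) x\<close>, and two functions \<open>m g x\<close> differ by a linear one.
  The quadratic upper bound \<open>f x' - f x \<le> m (gradient f x) x x'\<close>, the minimality
  \<open>m g x x' \<le> m g x y\<close> and the proximal PL condition
  \<open>m (gradient f x) x y \<le> - (l / L) * (f x - f xs)\<close> therefore combine into
  \<open>f x' - f x \<le> - (l / L) * (f x - f xs) + (gradient f x - g) \<bullet> (x' - y)\<close>
  (\<open>inexact_projected_step\<close>). Both \<open>x'\<close> and \<open>y\<close> lie in \<open>X\<close>, so the last term is at most
  \<open>diameter X * norm (gradient f x - g)\<close>.

  For the Gaussian oracle \<open>g\<close> the error \<open>gradient f x - g\<close> splits at the gradient of the smoothed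
  function. The bias is the average of \<open>gradient f x - gradient f (x + \<mu> u)\<close> over a Gaussian \<open>u\<close>,
  so it is at most \<open>L * \<mu>\<close> times the mean norm of \<open>u\<close>, hence at most \<open>L * \<mu> * sqrt n\<close>
  (\<open>smoothing_bias\<close>), which the constant \<open>(n + 3) powr (3 / 2) / 2\<close> dominates. The fluctuation
  has mean norm at most \<open>\<sigma> k\<close>, since a first moment is bounded by the root of the second. The
  point \<open>x k\<close> depends on \<open>u 0, ..., u (k - 1)\<close> only and is thus independent of \<open>u k\<close>
  (\<open>recursion_indep_var_next\<close>), which turns the conditional bound defining \<open>\<sigma> k\<close> into a bound in
  expectation (\<open>expected_step\<close>). Summing the expected steps telescopes.\<close>

section \<open>Functions with Lipschitz continuous gradient\<close>

lemma GDERIV_gradient: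
  fixes f :: "real^'n \<Rightarrow> real"
  assumes "f differentiable (at y)"
  shows "GDERIV f y :> gradient f y"
proof -
  obtain D where D: "(f has_derivative D) (at y)"
    using assms by (auto simp: differentiable_def)
  have "D = (\<lambda>h. h \<bullet> adjoint D 1)"
    using adjoint_works[OF has_derivative_linear[OF D], of _ 1] by auto
  with D have "GDERIV f y :> adjoint D 1"
    unfolding gderiv_def by simp
  then show ?thesis
    by (simp add: gradient_eqI)
qed

locale lipschitz_gradient =
  fixes f :: "real^'n \<Rightarrow> real" and L :: real
  assumes f_diff: "\<And>y. f differentiable (at y)"
    and L_pos: "L > 0"
    and f_lip: "\<And>y z. norm (gradient f y - gradient f z) \<le> L * norm (y - z)"
begin

lemma continuous_f: "continuous_on UNIV f"
  by (meson continuous_at_imp_continuous_on differentiable_imp_continuous_within f_diff)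

lemma continuous_gradient: "continuous_on UNIV (gradient f)"
  unfolding continuous_on_iff
proof (intro ballI allI impI)
  fix y and e :: real assume e: "e > 0"
  have "dist (gradient f z) (gradient f y) < e" if "dist z y < e / L" for z
    using f_lip[of z y] that L_pos by (simp add: dist_norm field_simps)
  then show "\<exists>d>0. \<forall>z\<in>UNIV. dist z y < d \<longrightarrow> dist (gradient f z) (gradient f y) < e"
    using e L_pos by (intro exI[of _ "e / L"]) auto
qed

text \<open>At time \<open>t\<close> on the segment from \<open>y\<close> to \<open>z\<close> the slope of \<open>f\<close> departs from its initial
  value by at most \<open>L * t * (norm (z - y))^2\<close>, and this integrates to the bound. The two-sided form is
  needed: the upper half is the descent inequality, and both halves together
  give the derivative of the smoothed function.\<close>

lemma quadratic_remainder:
  "\<bar>f z - f y - gradient f y \<bullet> (z - y)\<bar> \<le> L / 2 * (norm (z - y))\<^sup>2"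
proof -
  define v where "v = z - y"
  define r where "r = (\<lambda>t. f (y + t *\<^sub>R v) - t * (gradient f y \<bullet> v))"
  define q where "q = (\<lambda>t::real. L / 2 * t\<^sup>2 * (norm v)\<^sup>2)"
  have f': "((\<lambda>t. f (y + t *\<^sub>R v)) has_real_derivative v \<bullet> gradient f (y + t *\<^sub>R v)) (at t)" for t
  proof -
    have "((\<lambda>t. f (y + t *\<^sub>R v)) has_derivative (\<lambda>s. (s *\<^sub>R v) \<bullet> gradient f (y + t *\<^sub>R v))) (at t)"
      by (rule has_derivative_compose[where g = f])
        (use GDERIV_gradient[OF f_diff, of "y + t *\<^sub>R v"] in
          \<open>auto simp: gderiv_def intro!: derivative_eq_intros\<close>)
    then show ?thesis
      by (simp add: has_field_derivative_def mult_commute_abs)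
  qed
  have r': "(r has_real_derivative (gradient f (y + t *\<^sub>R v) - gradient f y) \<bullet> v) (at t)" for t
    unfolding r_def
    by (auto intro!: derivative_eq_intros f' simp: inner_diff_right inner_commute[of _ v])
  have q': "(q has_real_derivative L * t * (norm v)\<^sup>2) (at t)" for t
    unfolding q_def by (auto intro!: derivative_eq_intros)
  have slope: "\<bar>(gradient f (y + t *\<^sub>R v) - gradient f y) \<bullet> v\<bar> \<le> L * t * (norm v)\<^sup>2" if "0 \<le> t" for t
  proof -
    have "\<bar>(gradient f (y + t *\<^sub>R v) - gradient f y) \<bullet> v\<bar>
        \<le> norm (gradient f (y + t *\<^sub>R v) - gradient f y) * norm v"
      by (rule Cauchy_Schwarz_ineq2)
    also have "\<dots> \<le> (L * norm (t *\<^sub>R v)) * norm v"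
      using f_lip[of "y + t *\<^sub>R v" y] by (intro mult_right_mono) auto
    finally show ?thesis
      using that by (simp add: power2_eq_square mult_ac)
  qed
  have "r 1 - q 1 \<le> r 0 - q 0"
  proof (rule DERIV_nonpos_imp_nonincreasing[of 0 1 "\<lambda>t. r t - q t"])
    fix t :: real assume "0 \<le> t" "t \<le> 1"
    then show "\<exists>d. ((\<lambda>t. r t - q t) has_real_derivative d) (at t) \<and> d \<le> 0"
      using DERIV_diff[OF r' q', of t] slope[of t]
      by (intro exI[of _ "(gradient f (y + t *\<^sub>R v) - gradient f y) \<bullet> v - L * t * (norm v)\<^sup>2"]) auto
  qed simp
  moreover have "r 0 + q 0 \<le> r 1 + q 1"
  proof (rule DERIV_nonneg_imp_nondecreasing[of 0 1 "\<lambda>t. r t + q t"])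
    fix t :: real assume "0 \<le> t" "t \<le> 1"
    then show "\<exists>d. ((\<lambda>t. r t + q t) has_real_derivative d) (at t) \<and> d \<ge> 0"
      using DERIV_add[OF r' q', of t] slope[of t]
      by (intro exI[of _ "(gradient f (y + t *\<^sub>R v) - gradient f y) \<bullet> v + L * t * (norm v)\<^sup>2"]) auto
  qed simp
  moreover have "r 1 = f z - gradient f y \<bullet> (z - y)" "r 0 = f y"
      "q 1 = L / 2 * (norm (z - y))\<^sup>2" "q 0 = 0"
    by (simp_all add: r_def q_def v_def)
  ultimately show ?thesis
    by linarith
qed

end

section \<open>One projected step with an inexact gradient\<close>

definition prox_model :: "'a::real_inner \<Rightarrow> real \<Rightarrow> 'a \<Rightarrow> 'a \<Rightarrow> real"
  where "prox_model g a x z = a / 2 * (norm (z - x))\<^sup>2 + g \<bullet> (z - x)"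

text \<open>Completing the square turns the model into a squared distance to \<open>x - g / a\<close>, up to a
  constant.\<close>

lemma closest_point_minimises_prox_model:
  fixes X :: "'a::euclidean_space set"
  assumes "closed X" "a > 0" "z \<in> X"
  shows "prox_model g a x (closest_point X (x - (1 / a) *\<^sub>R g)) \<le> prox_model g a x z"
proof -
  have square: "prox_model g a x w
      = a / 2 * (dist (x - (1 / a) *\<^sub>R g) w)\<^sup>2 - (norm g)\<^sup>2 / (2 * a)" for w
  proof -
    have "dist (x - (1 / a) *\<^sub>R g) w = norm ((w - x) + (1 / a) *\<^sub>R g)"
      by (simp add: dist_norm norm_minus_commute algebra_simps)
    then have "(dist (x - (1 / a) *\<^sub>R g) w)\<^sup>2
        = (norm (w - x))\<^sup>2 + 2 / a * (g \<bullet> (w - x)) + (norm g)\<^sup>2 / a\<^sup>2"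
      by (simp only: power2_norm_eq_inner inner_add_left inner_add_right inner_scaleR_left
          inner_scaleR_right inner_commute[of "w - x" g]) (simp add: power2_eq_square add_divide_distrib)
    then show ?thesis
      using \<open>a > 0\<close> by (simp add: prox_model_def field_simps power2_eq_square)
  qed
  have "dist (x - (1 / a) *\<^sub>R g) (closest_point X (x - (1 / a) *\<^sub>R g)) \<le> dist (x - (1 / a) *\<^sub>R g) z"
    using assms by (intro closest_point_le) auto
  then show ?thesis
    using \<open>a > 0\<close> unfolding square by (simp add: mult_left_mono power_mono)
qed

text \<open>The exact projected gradient step attains the infimum in \<^const>\<open>prox_Q\<close>, so the proximal PL
  condition is a statement about the model's value at that point.\<close>

lemma proximal_PL_prox_model:
  assumes PL: "proximal_PL f X a l xs" and a: "a > 0" and X: "closed X" and x: "x \<in> X" and xs: "xs \<in> X"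
  shows "prox_model (gradient f x) a x (closest_point X (x - (1 / a) *\<^sub>R gradient f x))
    \<le> - (l / a) * (f x - f xs)"
proof -
  let ?y = "closest_point X (x - (1 / a) *\<^sub>R gradient f x)"
  let ?m = "prox_model (gradient f x) a x"
  define I where "I = (INF z\<in>X. ereal (?m z) + convex_indicator X z - convex_indicator X x)"
  have neg: "ereal (- 2 * a) * b = - (ereal (2 * a) * b)" for b
    unfolding ereal_mult_minus_left[symmetric] by simp
  have "ereal (?m ?y) \<le> I"
    unfolding I_def
    by (intro INF_greatest)
      (use x closest_point_minimises_prox_model[OF X a, of _ "gradient f x" x] in
        \<open>auto simp: convex_indicator_def\<close>)
  then have "ereal (- 2 * a) * I \<le> ereal (- 2 * a) * ereal (?m ?y)"
    using a ereal_mult_left_mono[of "ereal (?m ?y)" I "ereal (2 * a)"]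
    unfolding neg[of I] neg[of "ereal (?m ?y)"] ereal_minus_le_minus by auto
  then have "ereal (1 / 2) * (ereal (- 2 * a) * I)
      \<le> ereal (1 / 2) * (ereal (- 2 * a) * ereal (?m ?y))"
    by (rule ereal_mult_left_mono) simp
  moreover have "ereal l * (ereal (f x) - ereal (f xs)) \<le> ereal (1 / 2) * (ereal (- 2 * a) * I)"
    using PL x xs
    by (auto simp: proximal_PL_def prox_Q_def Let_def I_def prox_model_def convex_indicator_def)
  ultimately have "ereal l * (ereal (f x) - ereal (f xs))
      \<le> ereal (1 / 2) * (ereal (- 2 * a) * ereal (?m ?y))"
    by (rule order_trans[rotated])
  then have "l * (f x - f xs) \<le> - a * ?m ?y"
    by simp
  then show ?thesis
    using a by (simp add: field_simps)
qed

context lipschitz_gradient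
begin

text \<open>The error \<open>gradient f x - g\<close> is paired with the difference of the two candidate steps, because
  passing from the model for \<open>g\<close> to the one for \<open>gradient f x\<close> costs a linear term twice: once at
  \<open>x'\<close> and, after comparing the minimiser \<open>x'\<close> with \<open>y\<close>, once more at \<open>y\<close>.\<close>

lemma inexact_projected_step:
  fixes g
  assumes X: "closed X" and x: "x \<in> X" and xs: "xs \<in> X" and PL: "proximal_PL f X L l xs"
  defines "y \<equiv> closest_point X (x - (1 / L) *\<^sub>R gradient f x)"
    and "x' \<equiv> closest_point X (x - (1 / L) *\<^sub>R g)"
  shows "f x' - f x \<le> - (l / L) * (f x - f xs) + (gradient f x - g) \<bullet> (x' - y)"
proof -
  have y: "y \<in> X"
    unfolding y_def using X x by (intro closest_point_in_set) auto
  have "f x' - f x \<le> prox_model (gradient f x) L x x'"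
    using quadratic_remainder[of x' x] unfolding prox_model_def by linarith
  also have "\<dots> = prox_model g L x x' + (gradient f x - g) \<bullet> (x' - x)"
    by (simp add: prox_model_def algebra_simps)
  also have "\<dots> \<le> prox_model g L x y + (gradient f x - g) \<bullet> (x' - x)"
    unfolding x'_def using X L_pos y by (intro add_right_mono closest_point_minimises_prox_model)
  also have "\<dots> = prox_model (gradient f x) L x y + (gradient f x - g) \<bullet> (x' - y)"
    by (simp add: prox_model_def algebra_simps)
  also have "\<dots> \<le> - (l / L) * (f x - f xs) + (gradient f x - g) \<bullet> (x' - y)"
    unfolding y_def using proximal_PL_prox_model[OF PL L_pos X x xs] by simp
  finally show ?thesis .
qed

end

section \<open>The standard Gaussian measure\<close>

lemma norm_square_eq_sum_Basis: "(norm v)\<^sup>2 = (\<Sum>b\<in>Basis. (v \<bullet> b)\<^sup>2)"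
  unfolding power2_norm_eq_inner by (subst euclidean_inner) (simp add: power2_eq_square)

text \<open>The factorisation evaluates the normalising constant and reduces every Gaussian integral below
  to one-dimensional ones.\<close>

lemma gauss_density_eq_prod:
  "gauss_density (u :: real^'n) = (\<Prod>b\<in>Basis. std_normal_density (u \<bullet> b))"
proof -
  let ?w = "\<lambda>v :: real^'n. exp (- (1 / 2) * (norm v)\<^sup>2)"
  have w: "?w v = (\<Prod>b\<in>Basis. sqrt (2 * pi) * std_normal_density (v \<bullet> b))" for v
  proof -
    have "?w v = (\<Prod>b\<in>Basis. exp (- (v \<bullet> b)\<^sup>2 / 2))"
      by (simp add: norm_square_eq_sum_Basis exp_sum[symmetric] sum_divide_distrib sum_negf)
    then show ?thesis
      by (simp add: std_normal_density_def)
  qed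
  have "(\<integral>\<^sup>+v. ennreal (?w v) \<partial>lborel)
      = (\<Prod>b\<in>(Basis :: (real^'n) set). \<integral>\<^sup>+t. ennreal (sqrt (2 * pi) * std_normal_density t) \<partial>lborel)"
    unfolding w by (subst nn_integral_lborel_prod[symmetric]) (auto simp: prod_ennreal)
  also have "(\<integral>\<^sup>+t. ennreal (sqrt (2 * pi) * std_normal_density t) \<partial>lborel) = ennreal (sqrt (2 * pi))"
    by (subst nn_integral_eq_integral) auto
  finally have "(\<integral>\<^sup>+v. ennreal (?w v) \<partial>lborel) = ennreal (\<Prod>b\<in>(Basis :: (real^'n) set). sqrt (2 * pi))"
    by (simp add: ennreal_power)
  then have "(\<integral>v. ?w v \<partial>lborel) = (\<Prod>b\<in>(Basis :: (real^'n) set). sqrt (2 * pi))"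
    by (intro integral_eq_nn_integral[THEN trans]) (auto simp: prod_nonneg)
  then show ?thesis
    unfolding gauss_density_def by (simp only: w prod.distrib) simp
qed

lemma gauss_density_nonneg: "gauss_density u \<ge> 0"
  by (simp add: gauss_density_eq_prod prod_nonneg)

lemma measurable_gauss_density [measurable]: "gauss_density \<in> borel_measurable borel"
  unfolding gauss_density_def[abs_def] by measurable

definition gauss_measure :: "(real^'n) measure"
  where "gauss_measure = density lborel (\<lambda>v. ennreal (gauss_density v))"

lemma sets_gauss_measure [measurable_cong, simp]: "sets gauss_measure = sets borel"
  by (simp add: gauss_measure_def)

lemma space_gauss_measure [simp]: "space gauss_measure = UNIV"
  by (simp add: gauss_measure_def)

lemma gauss_smooth_eq: 
  assumes "continuous_on UNIV f"
  shows "gauss_smooth \<mu> f x = (\<integral>u. f (x + \<mu> *\<^sub>R u) \<partial>gauss_measure)"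
proof -
  have [measurable]: "f \<in> borel_measurable borel"
    using assms by (rule borel_measurable_continuous_onI)
  show ?thesis
    unfolding gauss_smooth_def gauss_measure_def
    by (subst integral_real_density) (auto simp: gauss_density_nonneg mult.commute)
qed

lemma nn_integral_gauss_prod:
  assumes [measurable]: "\<And>b. b \<in> Basis \<Longrightarrow> g b \<in> borel_measurable borel"
  shows "(\<integral>\<^sup>+u. (\<Prod>b\<in>Basis. g b (u \<bullet> b)) \<partial>(gauss_measure :: (real^'n) measure))
    = (\<Prod>b\<in>Basis. \<integral>\<^sup>+t. ennreal (std_normal_density t) * g b t \<partial>lborel)"
proof -
  have "(\<integral>\<^sup>+u. (\<Prod>b\<in>Basis. g b (u \<bullet> b)) \<partial>(gauss_measure :: (real^'n) measure))
      = (\<integral>\<^sup>+u. (\<Prod>b\<in>Basis. ennreal (std_normal_density (u \<bullet> b)) * g b (u \<bullet> b)) \<partial>lborel)"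
    unfolding gauss_measure_def
    by (subst nn_integral_density)
      (auto simp: gauss_density_eq_prod prod.distrib prod_ennreal[symmetric])
  also have "\<dots> = (\<Prod>b\<in>Basis. \<integral>\<^sup>+t. ennreal (std_normal_density t) * g b t \<partial>lborel)"
    by (rule nn_integral_lborel_prod) auto
  finally show ?thesis .
qed

lemma nn_integral_std_normal_density: "(\<integral>\<^sup>+t. ennreal (std_normal_density t) \<partial>lborel) = 1"
  by (subst nn_integral_eq_integral) auto

lemma prob_space_gauss_measure: "prob_space (gauss_measure :: (real^'n) measure)"
proof
  show "emeasure (gauss_measure :: (real^'n) measure) (space gauss_measure) = 1"
    using nn_integral_gauss_prod[of "\<lambda>_ :: real^'n. \<lambda>_. 1"]
    by (simp add: nn_integral_std_normal_density)
qed

lemma measure_gauss_measure_UNIV [simp]: "measure (gauss_measure :: (real^'n) measure) UNIV = 1"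
  using prob_space.prob_space[OF prob_space_gauss_measure] by simp

lemma integrable_gauss_const [simp]: "integrable gauss_measure (\<lambda>_. c)"
  by (simp add: prob_space_gauss_measure prob_space.finite_measure finite_measure.integrable_const)

text \<open>Each coordinate is standard normal and contributes its variance \<open>1\<close>.\<close>

lemma nn_integral_gauss_norm_square:
  "(\<integral>\<^sup>+u. ennreal ((norm u)\<^sup>2) \<partial>(gauss_measure :: (real^'n) measure)) = of_nat CARD('n)"
proof -
  have coord: "(\<integral>\<^sup>+u. ennreal ((u \<bullet> c)\<^sup>2) \<partial>gauss_measure) = 1" if c: "c \<in> Basis" for c :: "real^'n"
  proof -
    have "(\<integral>\<^sup>+u. ennreal ((u \<bullet> c)\<^sup>2) \<partial>gauss_measure)
        = (\<integral>\<^sup>+u. (\<Prod>b\<in>Basis. if b = c then ennreal ((u \<bullet> b)\<^sup>2) else 1) \<partial>gauss_measure)"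
      using c by simp
    also have "\<dots> = (\<Prod>b\<in>Basis. \<integral>\<^sup>+t. ennreal (std_normal_density t) * (if b = c then ennreal (t\<^sup>2) else 1) \<partial>lborel)"
      by (rule nn_integral_gauss_prod) auto
    also have "\<dots> = 1"
    proof (rule prod.neutral, rule)
      fix b
      have "(\<integral>\<^sup>+t. ennreal (std_normal_density t) * ennreal (t\<^sup>2) \<partial>lborel) = 1"
        using std_normal_moment_even[of 1]
        by (subst ennreal_mult[symmetric], simp, simp, subst nn_integral_eq_integral)
          (auto simp: has_bochner_integral_iff)
      then show "(\<integral>\<^sup>+t. ennreal (std_normal_density t) * (if b = c then ennreal (t\<^sup>2) else 1) \<partial>lborel) = 1"
        by (cases "b = c") (auto simp: nn_integral_std_normal_density)
    qed
    finally show ?thesis .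
  qed
  have "ennreal ((norm u)\<^sup>2) = (\<Sum>b\<in>Basis. ennreal ((u \<bullet> b)\<^sup>2))" for u :: "real^'n"
    by (simp add: norm_square_eq_sum_Basis)
  then have "(\<integral>\<^sup>+u. ennreal ((norm u)\<^sup>2) \<partial>(gauss_measure :: (real^'n) measure))
      = (\<Sum>b\<in>(Basis :: (real^'n) set). \<integral>\<^sup>+u. ennreal ((u \<bullet> b)\<^sup>2) \<partial>gauss_measure)"
    by (simp only:) (rule nn_integral_sum, measurable)
  also have "\<dots> = of_nat CARD('n)"
    by (simp add: coord)
  finally show ?thesis .
qed

text \<open>Any coefficient below \<open>1 / 2\<close> keeps the integral finite. With \<open>1 / 4\<close> each factor becomes a
  multiple of the normal density of variance \<open>2\<close>.\<close>

lemma integrable_exp_norm_square: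
  "integrable (gauss_measure :: (real^'n) measure) (\<lambda>u. exp ((norm u)\<^sup>2 / 4))"
proof (rule integrableI_nonneg)
  have "ennreal (exp ((norm u)\<^sup>2 / 4)) = (\<Prod>b\<in>Basis. ennreal (exp ((u \<bullet> b)\<^sup>2 / 4)))" for u :: "real^'n"
    by (simp add: norm_square_eq_sum_Basis prod_ennreal exp_sum[symmetric] sum_divide_distrib)
  then have "(\<integral>\<^sup>+u. ennreal (exp ((norm u)\<^sup>2 / 4)) \<partial>(gauss_measure :: (real^'n) measure))
      = (\<Prod>b\<in>(Basis :: (real^'n) set).
          \<integral>\<^sup>+t. ennreal (std_normal_density t) * ennreal (exp (t\<^sup>2 / 4)) \<partial>lborel)"
    by (simp only:) (rule nn_integral_gauss_prod, measurable)
  also have "(\<integral>\<^sup>+t. ennreal (std_normal_density t) * ennreal (exp (t\<^sup>2 / 4)) \<partial>lborel)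
      = (\<integral>\<^sup>+t. ennreal (sqrt 2 * normal_density 0 (sqrt 2) t) \<partial>lborel)"
  proof (rule nn_integral_cong)
    fix t :: real
    have "exp (- t\<^sup>2 / 2) * exp (t\<^sup>2 / 4) = exp (- t\<^sup>2 / 4)"
      unfolding mult_exp_exp by (rule arg_cong[of _ _ exp]) simp
    then have "std_normal_density t * exp (t\<^sup>2 / 4) = sqrt 2 * normal_density 0 (sqrt 2) t"
      by (simp add: normal_density_def real_sqrt_mult field_simps)
    then show "ennreal (std_normal_density t) * ennreal (exp (t\<^sup>2 / 4))
        = ennreal (sqrt 2 * normal_density 0 (sqrt 2) t)"
      by (simp add: ennreal_mult[symmetric])
  qed
  also have "\<dots> = ennreal (sqrt 2)"
    by (subst nn_integral_eq_integral) auto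
  also have "(\<Prod>b\<in>(Basis :: (real^'n) set). ennreal (sqrt 2)) < \<infinity>"
    by (simp add: prod_ennreal ennreal_power)
  finally show "(\<integral>\<^sup>+u. ennreal (exp ((norm u)\<^sup>2 / 4)) \<partial>(gauss_measure :: (real^'n) measure)) < \<infinity>" .
qed auto

text \<open>The exponential series dominates each of its terms, so polynomial growth is dominated by the
  integrable function \<open>exp ((norm u)^2 / 4)\<close>.\<close>

lemma integrable_gauss_poly_growth:
  fixes F :: "real^'n \<Rightarrow> 'b::{banach, second_countable_topology}"
  assumes [measurable]: "F \<in> borel_measurable borel"
    and growth: "\<And>u. norm (F u) \<le> C * (1 + (norm u)\<^sup>2) ^ k"
  shows "integrable gauss_measure F"
proof (rule Bochner_Integration.integrable_bound)
  let ?g = "\<lambda>u :: real^'n. \<bar>C\<bar> * (4 ^ k * fact k * exp (1 / 4) * exp ((norm u)\<^sup>2 / 4))"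
  show "integrable gauss_measure ?g"
    using integrable_exp_norm_square by (intro integrable_mult_right)
  show "AE u in gauss_measure. norm (F u) \<le> norm (?g u)"
  proof (rule AE_I2)
    fix u :: "real^'n"
    \<comment> \<open>chosen so that \<open>4 * s\<close> is the base of the power to be bounded\<close>
    define s where "s = 1 / 4 + (norm u)\<^sup>2 / 4"
    have "s \<ge> 0" by (simp add: s_def)
    then have "s ^ k / fact k \<le> exp s"
      using sum_le_suminf[OF summable_exp_generic, of "{k}" s]  
      by (simp add: exp_def divide_inverse mult.commute)
    then have "(4 * s) ^ k \<le> 4 ^ k * (fact k * exp s)"
      by (simp add: power_mult_distrib field_simps)
    also have "exp s = exp (1 / 4) * exp ((norm u)\<^sup>2 / 4)"
      by (simp add: s_def exp_add)
    finally have "(1 + (norm u)\<^sup>2) ^ k \<le> 4 ^ k * fact k * exp (1 / 4) * exp ((norm u)\<^sup>2 / 4)"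
      by (simp add: s_def mult_ac)
    then have "\<bar>C\<bar> * (1 + (norm u)\<^sup>2) ^ k \<le> ?g u"
      by (intro mult_left_mono) auto
    moreover have "C * (1 + (norm u)\<^sup>2) ^ k \<le> \<bar>C\<bar> * (1 + (norm u)\<^sup>2) ^ k"
      by (intro mult_right_mono) auto
    ultimately show "norm (F u) \<le> norm (?g u)"
      using growth[of u] by simp
  qed
qed measurable

lemma norm_le_one_plus_square: "norm v \<le> 1 + (norm v)\<^sup>2"
  using zero_le_power2[of "norm v - 1"] by (simp add: power2_diff) (smt (verit) norm_ge_zero)

lemma integrable_norm_gauss: "integrable (gauss_measure :: (real^'n) measure) norm"
  by (rule integrable_gauss_poly_growth[of _ 1 1]) (auto intro: norm_le_one_plus_square)

text \<open>Nonnegativity of the variance of \<open>norm u\<close> compares its mean with the second moment.\<close>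

lemma gauss_expectation_norm_le:
  "(\<integral>u. norm u \<partial>(gauss_measure :: (real^'n) measure)) \<le> sqrt (real CARD('n))"
proof -
  have sq: "integrable (gauss_measure :: (real^'n) measure) (\<lambda>u. (norm u)\<^sup>2)"
    by (rule integrable_gauss_poly_growth[of _ 1 1]) auto
  have "(\<integral>u. (norm u)\<^sup>2 \<partial>(gauss_measure :: (real^'n) measure)) = real CARD('n)"
    by (subst integral_eq_nn_integral) (auto simp: nn_integral_gauss_norm_square)
  then have "(\<integral>u. norm u \<partial>(gauss_measure :: (real^'n) measure))\<^sup>2 \<le> real CARD('n)"
    using prob_space.variance_eq[OF prob_space_gauss_measure integrable_norm_gauss sq]
      prob_space.variance_positive[OF prob_space_gauss_measure, of "norm :: real^'n \<Rightarrow> real"]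
    by simp
  then show ?thesis
    by (rule real_le_rsqrt)
qed

section \<open>Gaussian smoothing\<close>

context lipschitz_gradient
begin

lemma gradient_growth: "norm (gradient f (x + \<mu> *\<^sub>R u)) \<le> norm (gradient f x) + L * \<bar>\<mu>\<bar> * norm u"
  using f_lip[of "x + \<mu> *\<^sub>R u" x] norm_triangle_sub[of "gradient f (x + \<mu> *\<^sub>R u)" "gradient f x"]
  by simp

lemma f_growth:
  "\<bar>f (x + \<mu> *\<^sub>R u) - f x\<bar> \<le> (norm (gradient f x) * \<bar>\<mu>\<bar> + L / 2 * \<mu>\<^sup>2) * (1 + (norm u)\<^sup>2)"
proof -
  have "\<bar>f (x + \<mu> *\<^sub>R u) - f x\<bar> \<le> \<bar>gradient f x \<bullet> (\<mu> *\<^sub>R u)\<bar> + L / 2 * (norm (\<mu> *\<^sub>R u))\<^sup>2"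
    using quadratic_remainder[of "x + \<mu> *\<^sub>R u" x] unfolding add_diff_cancel_left' by linarith
  also have "\<dots> \<le> norm (gradient f x) * \<bar>\<mu>\<bar> * norm u + L / 2 * \<mu>\<^sup>2 * (norm u)\<^sup>2"
    using Cauchy_Schwarz_ineq2[of "gradient f x" "\<mu> *\<^sub>R u"] by (simp add: power_mult_distrib)
  also have "\<dots> \<le> norm (gradient f x) * \<bar>\<mu>\<bar> * (1 + (norm u)\<^sup>2) + L / 2 * \<mu>\<^sup>2 * (1 + (norm u)\<^sup>2)"
    using L_pos by (intro add_mono mult_left_mono norm_le_one_plus_square) auto
  finally show ?thesis
    by (simp add: algebra_simps)
qed

lemma measurable_f [measurable]: "f \<in> borel_measurable borel"
  by (rule borel_measurable_continuous_onI[OF continuous_f])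

lemma measurable_gradient [measurable]: "gradient f \<in> borel_measurable borel"
  by (rule borel_measurable_continuous_onI[OF continuous_gradient])

lemma integrable_f_shift: "integrable gauss_measure (\<lambda>u. f (x + \<mu> *\<^sub>R u))"
proof -
  have "integrable gauss_measure (\<lambda>u. f (x + \<mu> *\<^sub>R u) - f x)"
    by (rule integrable_gauss_poly_growth[where k = 1])
      (use f_growth[of x \<mu>] in \<open>auto\<close>)
  then have "integrable gauss_measure (\<lambda>u. (f (x + \<mu> *\<^sub>R u) - f x) + f x)"
    by (intro Bochner_Integration.integrable_add) auto
  then show ?thesis by simp
qed

lemma integrable_gradient_shift: "integrable gauss_measure (\<lambda>u. gradient f (x + \<mu> *\<^sub>R u))"
proof (rule integrable_gauss_poly_growth[where k = 1])
  fix u :: "real^'n"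
  have "L * \<bar>\<mu>\<bar> * norm u \<le> L * \<bar>\<mu>\<bar> * (1 + (norm u)\<^sup>2)"
    using L_pos by (intro mult_left_mono norm_le_one_plus_square) auto
  moreover have "norm (gradient f x) \<le> norm (gradient f x) * (1 + (norm u)\<^sup>2)"
    using mult_left_mono[of 1 "1 + (norm u)\<^sup>2" "norm (gradient f x)"] by simp
  ultimately show "norm (gradient f (x + \<mu> *\<^sub>R u))
      \<le> (norm (gradient f x) + L * \<bar>\<mu>\<bar>) * (1 + (norm u)\<^sup>2) ^ 1"
    using gradient_growth[of x \<mu> u] unfolding power_one_right distrib_right by linarith
qed measurable

text \<open>Averaging the Taylor remainder of \<open>f\<close> at \<open>x + \<mu> u\<close>, which is at most
  \<open>L / 2 * (norm v)^2\<close>, bounds the remainder of the smoothed function by the same quantity. The bound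
  is uniform in \<open>u\<close>, so no limit has to be exchanged with the integral.\<close>

lemma GDERIV_gauss_smooth:
  "GDERIV (gauss_smooth \<mu> f) x :> (\<integral>u. gradient f (x + \<mu> *\<^sub>R u) \<partial>gauss_measure)"
proof -
  define D where "D = (\<integral>u. gradient f (x + \<mu> *\<^sub>R u) \<partial>gauss_measure)"
  let ?s = "gauss_smooth \<mu> f"
  have rem: "\<bar>?s (x + v) - ?s x - v \<bullet> D\<bar> \<le> L / 2 * (norm v)\<^sup>2" for v
  proof -
    let ?R = "\<lambda>u. f (x + v + \<mu> *\<^sub>R u) - f (x + \<mu> *\<^sub>R u) - gradient f (x + \<mu> *\<^sub>R u) \<bullet> v"
    have int_inner: "integrable gauss_measure (\<lambda>u. gradient f (x + \<mu> *\<^sub>R u) \<bullet> v)"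
      by (intro integrable_inner_left integrable_gradient_shift)
    have intR: "integrable gauss_measure ?R"
      by (intro Bochner_Integration.integrable_diff integrable_f_shift int_inner)
    have "(\<integral>u. gradient f (x + \<mu> *\<^sub>R u) \<bullet> v \<partial>gauss_measure) = D \<bullet> v"
      unfolding D_def by (intro integral_inner_left integrable_gradient_shift)
    then have "?s (x + v) - ?s x - v \<bullet> D = (\<integral>u. ?R u \<partial>gauss_measure)"
      by (simp add: gauss_smooth_eq[OF continuous_f] integrable_f_shift int_inner inner_commute[of v D]
          del: integral_inner_left integral_inner_right)
    then have "\<bar>?s (x + v) - ?s x - v \<bullet> D\<bar> = \<bar>\<integral>u. ?R u \<partial>gauss_measure\<bar>"
      by (rule arg_cong)
    also have "\<dots> \<le> (\<integral>u. \<bar>?R u\<bar> \<partial>gauss_measure)"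
      by (rule integral_abs_bound)
    also have "\<dots> \<le> (\<integral>u. L / 2 * (norm v)\<^sup>2 \<partial>(gauss_measure :: (real^'n) measure))"
    proof (rule integral_mono)
      show "\<bar>?R u\<bar> \<le> L / 2 * (norm v)\<^sup>2" for u
        using quadratic_remainder[of "x + v + \<mu> *\<^sub>R u" "x + \<mu> *\<^sub>R u"] by simp
    qed (use intR in auto)
    also have "\<dots> = L / 2 * (norm v)\<^sup>2"
      by simp
    finally show ?thesis .
  qed
  have "(?s has_derivative (\<lambda>v. v \<bullet> D)) (at x)"
    unfolding has_derivative_at
  proof
    show "bounded_linear (\<lambda>v. v \<bullet> D)"
      by (rule bounded_linear_inner_left)
    show "(\<lambda>v. norm (?s (x + v) - ?s x - v \<bullet> D) / norm v) \<midarrow>0\<rightarrow> 0"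
    proof (rule Lim_null_comparison)
      show "\<forall>\<^sub>F v in at 0. norm (norm (?s (x + v) - ?s x - v \<bullet> D) / norm v) \<le> L / 2 * norm v"
        using rem by (intro always_eventually allI) 
          (auto simp: divide_le_eq power2_eq_square mult_ac)
      show "(\<lambda>v::real^'n. L / 2 * norm v) \<midarrow>0\<rightarrow> 0"
        by (auto intro!: tendsto_eq_intros)
    qed
  qed
  then show ?thesis
    by (simp add: gderiv_def D_def)
qed

lemma gradient_gauss_smooth:
  "gradient (gauss_smooth \<mu> f) x = (\<integral>u. gradient f (x + \<mu> *\<^sub>R u) \<partial>gauss_measure)"
  by (rule gradient_eqI[OF GDERIV_gauss_smooth])

text \<open>The gradient of the smoothed function is the average of \<open>gradient f (x + \<mu> u)\<close>, whose
  distance from \<open>gradient f x\<close> is at most \<open>L * \<bar>\<mu>\<bar> * norm u\<close>.\<close>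

lemma smoothing_bias:
  "norm (gradient f x - gradient (gauss_smooth \<mu> f) x) \<le> L * \<bar>\<mu>\<bar> * sqrt (real CARD('n))"
proof -
  have "gradient f x - gradient (gauss_smooth \<mu> f) x
      = (\<integral>u. gradient f x - gradient f (x + \<mu> *\<^sub>R u) \<partial>gauss_measure)"
    by (simp add: gradient_gauss_smooth integrable_gradient_shift)
  also have "norm \<dots> \<le> (\<integral>u. norm (gradient f x - gradient f (x + \<mu> *\<^sub>R u)) \<partial>gauss_measure)"
    by (rule integral_norm_bound)
  also have "\<dots> \<le> (\<integral>u. L * \<bar>\<mu>\<bar> * norm u \<partial>(gauss_measure :: (real^'n) measure))"
  proof (rule integral_mono)
    show "norm (gradient f x - gradient f (x + \<mu> *\<^sub>R u)) \<le> L * \<bar>\<mu>\<bar> * norm u" for u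
      using f_lip[of x "x + \<mu> *\<^sub>R u"] by simp
  qed (auto intro!: integrable_norm Bochner_Integration.integrable_diff integrable_gradient_shift
      integrable_norm_gauss)
  also have "\<dots> = L * \<bar>\<mu>\<bar> * (\<integral>u. norm u \<partial>(gauss_measure :: (real^'n) measure))"
    by simp
  also have "\<dots> \<le> L * \<bar>\<mu>\<bar> * sqrt (real CARD('n))"
    using L_pos by (intro mult_left_mono gauss_expectation_norm_le) auto
  finally show ?thesis .
qed

text \<open>This makes the smoothed gradient continuous, hence measurable, so that the oracle error is
  a random variable.\<close>

lemma lipschitz_gradient_gauss_smooth: "lipschitz_gradient (gauss_smooth \<mu> f) L"
proof
  show "gauss_smooth \<mu> f differentiable (at y)" for y
    using GDERIV_gauss_smooth[of \<mu> y] unfolding gderiv_def differentiable_def by blast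
  show "norm (gradient (gauss_smooth \<mu> f) y - gradient (gauss_smooth \<mu> f) z) \<le> L * norm (y - z)"
    for y z
  proof -
    have "gradient (gauss_smooth \<mu> f) y - gradient (gauss_smooth \<mu> f) z
        = (\<integral>u. gradient f (y + \<mu> *\<^sub>R u) - gradient f (z + \<mu> *\<^sub>R u) \<partial>gauss_measure)"
      by (simp add: gradient_gauss_smooth integrable_gradient_shift)
    also have "norm \<dots>
        \<le> (\<integral>u. norm (gradient f (y + \<mu> *\<^sub>R u) - gradient f (z + \<mu> *\<^sub>R u)) \<partial>gauss_measure)"
      by (rule integral_norm_bound)
    also have "\<dots> \<le> (\<integral>u. L * norm (y - z) \<partial>(gauss_measure :: (real^'n) measure))"
    proof (rule integral_mono)
      show "norm (gradient f (y + \<mu> *\<^sub>R u) - gradient f (z + \<mu> *\<^sub>R u)) \<le> L * norm (y - z)" for u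
        using f_lip[of "y + \<mu> *\<^sub>R u" "z + \<mu> *\<^sub>R u"] by simp
    qed (auto intro!: integrable_norm Bochner_Integration.integrable_diff integrable_gradient_shift)
    also have "\<dots> = L * norm (y - z)"
      by simp
    finally show ?thesis .
  qed
qed (fact L_pos)

end

section \<open>Independence of the iterates and the next direction\<close>

text \<open>Averaging over a variable independent of \<open>X\<close> while \<open>X\<close> is kept fixed is the conditional
  expectation given \<open>X\<close>; this is how a bound for almost every value of the current iterate becomes
  a bound on a joint expectation.\<close>

lemma (in prob_space) nn_integral_indep_var:
  assumes indep: "indep_var S X T Y" and g [measurable]: "g \<in> borel_measurable (S \<Otimes>\<^sub>M T)"
  shows "(\<integral>\<^sup>+\<omega>. g (X \<omega>, Y \<omega>) \<partial>M) = (\<integral>\<^sup>+\<omega>. \<integral>\<^sup>+\<omega>'. g (X \<omega>, Y \<omega>') \<partial>M \<partial>M)"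
proof -
  have [measurable]: "X \<in> measurable M S" "Y \<in> measurable M T"
    using indep by (auto dest: indep_var_rv1 indep_var_rv2)
  interpret Y: prob_space "distr M T Y"
    by (rule prob_space_distr) measurable
  have "(\<integral>\<^sup>+\<omega>. g (X \<omega>, Y \<omega>) \<partial>M) = (\<integral>\<^sup>+p. g p \<partial>distr M (S \<Otimes>\<^sub>M T) (\<lambda>\<omega>. (X \<omega>, Y \<omega>)))"
    by (simp add: nn_integral_distr)
  also have "distr M (S \<Otimes>\<^sub>M T) (\<lambda>\<omega>. (X \<omega>, Y \<omega>)) = distr M S X \<Otimes>\<^sub>M distr M T Y"
    using indep by (simp add: indep_var_distribution_eq)
  also have "(\<integral>\<^sup>+p. g p \<partial>(distr M S X \<Otimes>\<^sub>M distr M T Y))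
      = (\<integral>\<^sup>+a. \<integral>\<^sup>+b. g (a, b) \<partial>distr M T Y \<partial>distr M S X)"
    by (rule Y.nn_integral_fst[symmetric]) measurable
  also have "\<dots> = (\<integral>\<^sup>+\<omega>. \<integral>\<^sup>+b. g (X \<omega>, b) \<partial>distr M T Y \<partial>M)"
    by (rule nn_integral_distr) measurable
  also have "\<dots> = (\<integral>\<^sup>+\<omega>. \<integral>\<^sup>+\<omega>'. g (X \<omega>, Y \<omega>') \<partial>M \<partial>M)"
    by (intro nn_integral_cong nn_integral_distr) (auto dest: measurable_space[of X M S])
  finally show ?thesis .
qed

text \<open>Unrolling the recursion exhibits \<open>x k\<close> as a measurable function of \<open>u 0, ..., u (k - 1)\<close>.\<close>

lemma (in prob_space) recursion_indep_var_next:
  fixes u x :: "nat \<Rightarrow> 'a \<Rightarrow> 'b"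
  assumes indep: "indep_vars (\<lambda>_. N) u UNIV"
    and x_0: "\<And>\<omega>. \<omega> \<in> space M \<Longrightarrow> x 0 \<omega> = x0" and x0: "x0 \<in> space K"
    and x_Suc: "\<And>k \<omega>. \<omega> \<in> space M \<Longrightarrow> x (Suc k) \<omega> = T k (x k \<omega>, u k \<omega>)"
    and T: "\<And>k. T k \<in> measurable (K \<Otimes>\<^sub>M N) K"
  shows "indep_var K (x k) N (u k)"
proof -
  have "\<exists>R. R \<in> measurable (PiM {..<k} (\<lambda>_. N)) K
      \<and> (\<forall>\<omega>\<in>space M. x k \<omega> = R (restrict (\<lambda>i. u i \<omega>) {..<k}))"
  proof (induction k)
    case 0
    show ?case
      by (intro exI[of _ "\<lambda>_. x0"]) (use x_0 x0 in auto)
  next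
    case (Suc k)
    then obtain R where R: "R \<in> measurable (PiM {..<k} (\<lambda>_. N)) K"
      and x_k: "\<And>\<omega>. \<omega> \<in> space M \<Longrightarrow> x k \<omega> = R (restrict (\<lambda>i. u i \<omega>) {..<k})"
      by blast
    have past: "(\<lambda>v. R (restrict v {..<k})) \<in> measurable (PiM {..<Suc k} (\<lambda>_. N)) K"
      by (rule measurable_compose[OF measurable_restrict_subset R]) auto
    have new: "(\<lambda>v. v k) \<in> measurable (PiM {..<Suc k} (\<lambda>_. N)) N"
      by (rule measurable_component_singleton) simp
    have restr: "{..<Suc k} \<inter> {..<k} = {..<k}"
      by auto
    show ?case
      by (intro exI[of _ "\<lambda>v. T k (R (restrict v {..<k}), v k)"] conjI
          measurable_compose[OF measurable_Pair[OF past new] T])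
        (auto simp: x_Suc x_k restr restrict_restrict restrict_apply' simp del: restrict_apply)
  qed
  then obtain R where R: "R \<in> measurable (PiM {..<k} (\<lambda>_. N)) K"
    and x_k: "\<And>\<omega>. \<omega> \<in> space M \<Longrightarrow> x k \<omega> = R (restrict (\<lambda>i. u i \<omega>) {..<k})"
    by blast
  have "indep_var (PiM {..<k} (\<lambda>_. N)) (\<lambda>\<omega>. restrict (\<lambda>i. u i \<omega>) {..<k})
      (PiM {k} (\<lambda>_. N)) (\<lambda>\<omega>. restrict (\<lambda>i. u i \<omega>) {k})"
    by (rule indep_var_restrict[OF indep]) auto
  from indep_var_compose[OF this R measurable_component_singleton[of k]]
  have "indep_var K (R \<circ> (\<lambda>\<omega>. restrict (\<lambda>i. u i \<omega>) {..<k})) N ((\<lambda>v. v k) \<circ> (\<lambda>\<omega>. restrict (\<lambda>i. u i \<omega>) {k}))"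
    by simp
  moreover have "distr M (K \<Otimes>\<^sub>M N) (\<lambda>\<omega>. (x k \<omega>, u k \<omega>))
      = distr M (K \<Otimes>\<^sub>M N) (\<lambda>\<omega>. (R (restrict (\<lambda>i. u i \<omega>) {..<k}), u k \<omega>))"
    by (intro distr_cong) (auto simp: x_k)
  moreover have "distr M K (x k) = distr M K (\<lambda>\<omega>. R (restrict (\<lambda>i. u i \<omega>) {..<k}))"
    by (intro distr_cong) (auto simp: x_k)
  moreover have "random_variable K (x k)
      \<longleftrightarrow> random_variable K (\<lambda>\<omega>. R (restrict (\<lambda>i. u i \<omega>) {..<k}))"
    by (intro measurable_cong) (auto simp: x_k)
  ultimately show ?thesis
    by (simp add: indep_var_distribution_eq comp_def)
qed

lemma (in prob_space) expectation_le_of_square: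
  fixes Z :: "'a \<Rightarrow> real"
  assumes "integrable M Z" "integrable M (\<lambda>\<omega>. (Z \<omega>)\<^sup>2)" "expectation (\<lambda>\<omega>. (Z \<omega>)\<^sup>2) \<le> s\<^sup>2" "s \<ge> 0"
  shows "expectation Z \<le> s"
proof -
  have "(expectation Z)\<^sup>2 \<le> s\<^sup>2"
    using variance_eq[OF assms(1,2)] variance_positive[of Z] assms(3) by simp
  then show ?thesis
    using assms(4) by (rule power2_le_imp_le)
qed

section \<open>The randomised method in expectation\<close>

lemma sqrt_dim_le: "sqrt n \<le> (n + 3) powr (3 / 2) / 2" if "n \<ge> 0" for n :: real
proof -
  have "2 * sqrt n \<le> (n + 3) * sqrt (n + 3)"
    using that by (intro mult_mono real_sqrt_le_mono) auto
  also have "\<dots> = (n + 3) powr 1 * (n + 3) powr (1 / 2)"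
    using that by (simp add: powr_half_sqrt)
  also have "\<dots> = (n + 3) powr (3 / 2)"
    by (subst powr_add[symmetric]) simp
  finally show ?thesis by simp
qed

context lipschitz_gradient
begin

definition oracle_error :: "real \<Rightarrow> real^'n \<Rightarrow> real^'n \<Rightarrow> real"
  where "oracle_error \<mu> y v = norm (gauss_oracle (mat 1) \<mu> f y v - gradient (gauss_smooth \<mu> f) y)"

lemma measurable_gradient_gauss_smooth [measurable]:
  "gradient (gauss_smooth \<mu> f) \<in> borel_measurable borel"
  by (rule lipschitz_gradient.measurable_gradient[OF lipschitz_gradient_gauss_smooth])

lemma measurable_gauss_oracle [measurable]:
  "(\<lambda>p. gauss_oracle (mat 1) \<mu> f (fst p) (snd p)) \<in> borel_measurable (borel \<Otimes>\<^sub>M borel)"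
  unfolding gauss_oracle_def by simp

lemma measurable_oracle_error [measurable]:
  "(\<lambda>p. oracle_error \<mu> (fst p) (snd p)) \<in> borel_measurable (borel \<Otimes>\<^sub>M borel)"
  unfolding oracle_error_def by measurable

text \<open>The finite difference grows quadratically in the direction \<open>v\<close> and is multiplied by \<open>v\<close>, so the
  error grows at most like a cubic.\<close>

lemma oracle_error_growth:
  "\<exists>C. \<forall>v. oracle_error \<mu> y v \<le> C * (1 + (norm v)\<^sup>2)\<^sup>2"
proof (intro exI allI)
  define c where "c = norm (gradient f y) * \<bar>\<mu>\<bar> + L / 2 * \<mu>\<^sup>2"
  define d where "d = norm (gradient (gauss_smooth \<mu> f) y)"
  fix v :: "real^'n"
  have "oracle_error \<mu> y v \<le> norm (gauss_oracle (mat 1) \<mu> f y v) + d"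
    unfolding oracle_error_def d_def by (rule norm_triangle_ineq4)
  also have "norm (gauss_oracle (mat 1) \<mu> f y v) = \<bar>f (y + \<mu> *\<^sub>R v) - f y\<bar> / \<bar>\<mu>\<bar> * norm v"
    by (simp add: gauss_oracle_def)
  also have "\<dots> \<le> (c * (1 + (norm v)\<^sup>2)) / \<bar>\<mu>\<bar> * (1 + (norm v)\<^sup>2)"
    using L_pos unfolding c_def
    by (intro mult_mono divide_right_mono f_growth norm_le_one_plus_square) auto
  also have "(c * (1 + (norm v)\<^sup>2)) / \<bar>\<mu>\<bar> * (1 + (norm v)\<^sup>2) = c / \<bar>\<mu>\<bar> * (1 + (norm v)\<^sup>2)\<^sup>2"
    by (simp add: power2_eq_square)
  also have "d \<le> d * (1 + (norm v)\<^sup>2)\<^sup>2"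
    using mult_left_mono[of 1 "(1 + (norm v)\<^sup>2)\<^sup>2" d] by (simp add: d_def)
  finally show "oracle_error \<mu> y v \<le> (c / \<bar>\<mu>\<bar> + d) * (1 + (norm v)\<^sup>2)\<^sup>2"
    by (simp add: distrib_right)
qed

text \<open>Integrability of the square makes the bound defining \<open>\<sigma> k\<close> meaningful: the integral of a
  function that is not integrable is \<open>0\<close> by convention, and would bound nothing.\<close>

lemma integrable_oracle_error:
  "integrable gauss_measure (\<lambda>v. oracle_error \<mu> y v)" (is ?first)
  "integrable gauss_measure (\<lambda>v. (oracle_error \<mu> y v)\<^sup>2)" (is ?second)
proof -
  obtain C where C: "\<And>v. oracle_error \<mu> y v \<le> C * (1 + (norm v)\<^sup>2)\<^sup>2"
    using oracle_error_growth by blast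
  have nonneg: "oracle_error \<mu> y v \<ge> 0" for v
    by (simp add: oracle_error_def)
  have [measurable]: "oracle_error \<mu> y \<in> borel_measurable borel"
    using measurable_compose[OF measurable_Pair1' measurable_oracle_error[of \<mu>], of y] by simp
  show ?first
    by (rule integrable_gauss_poly_growth[where k = 2 and C = C]) (use C nonneg in auto)
  show ?second
  proof (rule integrable_gauss_poly_growth[where k = 4 and C = "C\<^sup>2"])
    fix v :: "real^'n"
    have "(oracle_error \<mu> y v)\<^sup>2 \<le> (C * (1 + (norm v)\<^sup>2)\<^sup>2)\<^sup>2"
      using C nonneg by (intro power_mono)
    then show "norm ((oracle_error \<mu> y v)\<^sup>2) \<le> C\<^sup>2 * (1 + (norm v)\<^sup>2) ^ 4"
      by (simp add: power_mult_distrib flip: power_mult)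
  qed measurable
qed

lemma integrable_f_compact:
  assumes X: "compact X" and M: "prob_space M"
    and Y [measurable]: "Y \<in> borel_measurable M" and Y_in: "\<And>\<omega>. \<omega> \<in> space M \<Longrightarrow> Y \<omega> \<in> X"
  shows "integrable M (\<lambda>\<omega>. f (Y \<omega>))"
proof -
  have "compact (f ` X)"
    using continuous_on_subset[OF continuous_f] X by (intro compact_continuous_image) auto
  then obtain K where K: "\<And>z. z \<in> X \<Longrightarrow> \<bar>f z\<bar> \<le> K"
    using compact_imp_bounded[of "f ` X"] unfolding bounded_iff by auto
  interpret prob_space M by (rule M)
  show ?thesis
    using K Y_in by (intro integrable_const_bound[of _ K]) auto
qed

text \<open>The expected form of \<open>inexact_projected_step\<close> for the Gaussian oracle: the error is split into
  the deterministic bias of smoothing and a fluctuation, whose mean is computed with the state \<open>Y\<close>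
  kept fixed, as \<open>Y\<close> and the direction \<open>U\<close> are independent.\<close>

lemma expected_step:
  fixes M :: "'w measure" and Y U Y' :: "'w \<Rightarrow> real^'n"
  assumes X: "compact X" "convex X" and xs: "xs \<in> X" and PL: "proximal_PL f X L l xs"
    and M: "prob_space M"
    and indep: "prob_space.indep_var M borel Y borel U"
    and U: "distr M borel U = gauss_measure"
    and Y: "\<And>\<omega>. \<omega> \<in> space M \<Longrightarrow> Y \<omega> \<in> X"
    and Y': "\<And>\<omega>. \<omega> \<in> space M \<Longrightarrow>
      Y' \<omega> = closest_point X (Y \<omega> - (1 / L) *\<^sub>R gauss_oracle (mat 1) \<mu> f (Y \<omega>) (U \<omega>))"
    and s: "s \<ge> 0" "AE \<omega> in M. (\<integral>\<omega>'. (oracle_error \<mu> (Y \<omega>) (U \<omega>'))\<^sup>2 \<partial>M) \<le> s\<^sup>2"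
    and Y'_meas: "Y' \<in> borel_measurable M"
  shows "(\<integral>\<omega>. f (Y' \<omega>) \<partial>M) - (\<integral>\<omega>. f (Y \<omega>) \<partial>M)
    \<le> - (l / L) * ((\<integral>\<omega>. f (Y \<omega>) \<partial>M) - f xs)
      + diameter X * (L * \<bar>\<mu>\<bar> * sqrt (real CARD('n)) + s)"
proof -
  interpret prob_space M by (rule M)
  note [measurable] = indep_var_rv1[OF indep] indep_var_rv2[OF indep] Y'_meas
  have closed: "closed X" and bounded: "bounded X" and nonempty: "X \<noteq> {}"
    using X xs by (auto simp: compact_imp_closed compact_imp_bounded)
  let ?b = "L * \<bar>\<mu>\<bar> * sqrt (real CARD('n))"
  let ?G = "\<lambda>\<omega>. oracle_error \<mu> (Y \<omega>) (U \<omega>)"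
  have G_meas [measurable]: "?G \<in> borel_measurable M"
    using measurable_compose[OF measurable_Pair measurable_oracle_error[of \<mu>], of Y M U] by simp
  have Y'_in: "Y' \<omega> \<in> X" if "\<omega> \<in> space M" for \<omega>
    unfolding Y'[OF that] using closed nonempty by (rule closest_point_in_set)
  have int_Y: "integrable M (\<lambda>\<omega>. f (Y \<omega>))" and int_Y': "integrable M (\<lambda>\<omega>. f (Y' \<omega>))"
    using Y Y'_in by (auto intro!: integrable_f_compact[OF X(1) M])
  have error: "AE \<omega> in M. (\<integral>\<^sup>+\<omega>'. ennreal (oracle_error \<mu> (Y \<omega>) (U \<omega>')) \<partial>M) \<le> ennreal s"
    using s(2)
  proof eventually_elim
    fix \<omega> assume second: "(\<integral>\<omega>'. (oracle_error \<mu> (Y \<omega>) (U \<omega>'))\<^sup>2 \<partial>M) \<le> s\<^sup>2"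
    have "integrable (distr M borel U) (oracle_error \<mu> (Y \<omega>))"
        "integrable (distr M borel U) (\<lambda>v. (oracle_error \<mu> (Y \<omega>) v)\<^sup>2)"
      unfolding U by (rule integrable_oracle_error)+
    then have int: "integrable M (\<lambda>\<omega>'. oracle_error \<mu> (Y \<omega>) (U \<omega>'))"
        "integrable M (\<lambda>\<omega>'. (oracle_error \<mu> (Y \<omega>) (U \<omega>'))\<^sup>2)"
      by (auto intro!: integrable_distr[of U M borel])
    have "(\<integral>\<^sup>+\<omega>'. ennreal (oracle_error \<mu> (Y \<omega>) (U \<omega>')) \<partial>M)
        = ennreal (expectation (\<lambda>\<omega>'. oracle_error \<mu> (Y \<omega>) (U \<omega>')))"
      by (rule nn_integral_eq_integral[OF int(1)]) (simp add: oracle_error_def)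
    also have "\<dots> \<le> ennreal s"
      by (rule ennreal_leI[OF expectation_le_of_square[OF int second s(1)]])
    finally show "(\<integral>\<^sup>+\<omega>'. ennreal (oracle_error \<mu> (Y \<omega>) (U \<omega>')) \<partial>M) \<le> ennreal s" .
  qed
  have "(\<integral>\<^sup>+\<omega>. ennreal (?G \<omega>) \<partial>M)
      = (\<integral>\<^sup>+\<omega>. \<integral>\<^sup>+\<omega>'. ennreal (oracle_error \<mu> (Y \<omega>) (U \<omega>')) \<partial>M \<partial>M)"
    using nn_integral_indep_var[OF indep, of "\<lambda>p. ennreal (oracle_error \<mu> (fst p) (snd p))"] by simp
  also have "\<dots> \<le> (\<integral>\<^sup>+\<omega>. ennreal s \<partial>M)"
    using error by (rule nn_integral_mono_AE)
  also have "\<dots> = ennreal s"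
    by (simp add: emeasure_space_1)
  finally have nn_G: "(\<integral>\<^sup>+\<omega>. ennreal (?G \<omega>) \<partial>M) \<le> ennreal s" .
  have G_nonneg: "?G \<omega> \<ge> 0" for \<omega>
    by (simp add: oracle_error_def)
  have int_G: "integrable M ?G"
    using nn_G G_nonneg by (intro integrableI_nonneg) (auto simp: le_less_trans)
  have "ennreal (expectation ?G) \<le> ennreal s"
    using nn_G G_nonneg by (subst nn_integral_eq_integral[symmetric, OF int_G]) auto
  then have E_G: "expectation ?G \<le> s"
    using s(1) by (simp add: ennreal_le_iff)
  have step: "f (Y' \<omega>) \<le> f (Y \<omega>) - (l / L) * (f (Y \<omega>) - f xs) + diameter X * (?b + ?G \<omega>)"
    if \<omega>: "\<omega> \<in> space M" for \<omega>
  proof -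
    let ?g = "gauss_oracle (mat 1) \<mu> f (Y \<omega>) (U \<omega>)"
    let ?y = "closest_point X (Y \<omega> - (1 / L) *\<^sub>R gradient f (Y \<omega>))"
    have y: "?y \<in> X"
      using closed nonempty by (rule closest_point_in_set)
    have "(gradient f (Y \<omega>) - ?g) \<bullet> (Y' \<omega> - ?y) \<le> norm (gradient f (Y \<omega>) - ?g) * norm (Y' \<omega> - ?y)"
      by (rule norm_cauchy_schwarz)
    also have "\<dots> \<le> (?b + ?G \<omega>) * diameter X"
    proof (rule mult_mono)
      show "norm (Y' \<omega> - ?y) \<le> diameter X"
        using diameter_bounded_bound[OF bounded Y'_in[OF \<omega>] y] by (simp add: dist_norm)
      show "norm (gradient f (Y \<omega>) - ?g) \<le> ?b + ?G \<omega>"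
        using norm_triangle_ineq4[of "gradient f (Y \<omega>) - gradient (gauss_smooth \<mu> f) (Y \<omega>)"
            "?g - gradient (gauss_smooth \<mu> f) (Y \<omega>)"] smoothing_bias[of "Y \<omega>" \<mu>]
        by (simp add: oracle_error_def)
    qed (use L_pos G_nonneg in auto)
    finally show ?thesis
      using inexact_projected_step[OF closed Y[OF \<omega>] xs PL, of ?g]
      unfolding Y'[OF \<omega>] by (simp add: mult.commute)
  qed
  have "expectation (\<lambda>\<omega>. f (Y' \<omega>))
      \<le> expectation (\<lambda>\<omega>. f (Y \<omega>) - (l / L) * (f (Y \<omega>) - f xs) + diameter X * (?b + ?G \<omega>))"
    by (intro integral_mono step int_Y' Bochner_Integration.integrable_add
        Bochner_Integration.integrable_diff integrable_mult_right integrable_const int_Y int_G)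
  also have "\<dots> = expectation (\<lambda>\<omega>. f (Y \<omega>)) - (l / L) * (expectation (\<lambda>\<omega>. f (Y \<omega>)) - f xs)
      + diameter X * (?b + expectation ?G)"
    using int_Y int_G by (simp add: prob_space)
  also have "\<dots> \<le> expectation (\<lambda>\<omega>. f (Y \<omega>)) - (l / L) * (expectation (\<lambda>\<omega>. f (Y \<omega>)) - f xs)
      + diameter X * (?b + s)"
    using E_G bounded by (intro add_left_mono mult_left_mono) (auto simp: diameter_ge_0)
  finally show ?thesis
    by simp
qed

end

theorem theorem2:
  fixes X :: "(real^'n) set"
    and f :: "real^'n \<Rightarrow> real"
    and B :: "real^'n^'n"
    and L l \<mu> :: real
    and xs x0 :: "real^'n"
    and M :: "'w measure"
    and u x :: "nat \<Rightarrow> 'w \<Rightarrow> real^'n"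
    and h \<sigma> \<Phi> :: "nat \<Rightarrow> real"
    and N :: nat
  assumes X: "X \<noteq> {}" "compact X" "convex X"
    and f_diff: "\<And>y. f differentiable (at y)"
    and L_pos: "L > 0"
    and f_lip: "\<And>y z. norm (gradient f y - gradient f z) \<le> L * norm (y - z)"
    and xs: "xs \<in> X" "\<And>y. y \<in> X \<Longrightarrow> f xs \<le> f y"
    and l_pos: "l > 0"
    and PL: "proximal_PL f X L l xs"
    and \<mu>_pos: "\<mu> > 0"
    and B: "B = mat 1"
    and M: "prob_space M"
    and u_indep: "prob_space.indep_vars M (\<lambda>_. borel) u UNIV"
    and u_gauss: "\<And>k. distributed M lborel (u k) (\<lambda>v. ennreal (gauss_density v))"
    and x0: "x0 \<in> X"
    and h: "\<And>k. h k = 1 / L"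
    and x_0: "\<And>\<omega>. \<omega> \<in> space M \<Longrightarrow> x 0 \<omega> = x0"
    and x_Suc: "\<And>k \<omega>. \<omega> \<in> space M \<Longrightarrow>
      x (Suc k) \<omega> = closest_point X (x k \<omega> - h k *\<^sub>R gauss_oracle B \<mu> f (x k \<omega>) (u k \<omega>))"
    and \<sigma>_nonneg: "\<And>k. \<sigma> k \<ge> 0"
    and \<sigma>: "\<And>k. AE \<omega> in M.
      (\<integral>\<omega>'. (norm (gauss_oracle B \<mu> f (x k \<omega>) (u k \<omega>')
                  - gradient (gauss_smooth \<mu> f) (x k \<omega>)))\<^sup>2 \<partial>M) \<le> (\<sigma> k)\<^sup>2"
    and \<Phi>_0: "\<Phi> 0 = f x0"
    and \<Phi>: "\<And>k. k \<ge> 1 \<Longrightarrow> \<Phi> k = (\<integral>\<omega>. f (x k \<omega>) \<partial>M)"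
  shows "1 / (real N + 1) * (\<Sum>k=0..N. \<Phi> k - f xs)
    \<le> L / l * ((f x0 - f xs) / (real N + 1))
      + \<mu> * diameter X * L\<^sup>2 * (real CARD('n) + 3) powr (3 / 2) / (2 * l)
      + L * diameter X / (l * (real N + 1)) * (\<Sum>k=0..N. \<sigma> k)
      + 1 / (l * (real N + 1)) * (\<Sum>k=0..N. (\<sigma> k)\<^sup>2)"
proof -
  interpret lipschitz_gradient f L
    by unfold_locales (fact f_diff L_pos f_lip)+
  interpret prob_space M by (rule M)
  have closed: "closed X" and bounded: "bounded X"
    using X by (auto simp: compact_imp_closed compact_imp_bounded)
  define d where "d = diameter X"
  define b where "b = \<mu> * L * (real CARD('n) + 3) powr (3 / 2) / 2"
  have d: "d \<ge> 0"
    unfolding d_def using bounded by (rule diameter_ge_0)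
  have \<Phi>_eq: "\<Phi> k = expectation (\<lambda>\<omega>. f (x k \<omega>))" for k
  proof (cases k)
    case 0
    have "expectation (\<lambda>\<omega>. f (x 0 \<omega>)) = expectation (\<lambda>\<omega>. f x0)"
      by (intro Bochner_Integration.integral_cong) (auto simp: x_0)
    with 0 show ?thesis
      by (simp add: \<Phi>_0 prob_space)
  qed (simp add: \<Phi>)
  have x_in: "x k \<omega> \<in> X" if "\<omega> \<in> space M" for k \<omega>
    using that closed X(1) x0 by (cases k) (auto simp: x_0 x_Suc intro: closest_point_in_set)
  have step_meas: "(\<lambda>p. closest_point X (fst p - (1 / L) *\<^sub>R gauss_oracle (mat 1) \<mu> f (fst p) (snd p)))
      \<in> borel_measurable (borel \<Otimes>\<^sub>M borel)"
    by (rule borel_measurable_continuous_on[OF continuous_on_closest_point[OF X(3) closed X(1)]])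
      measurable
  have indep: "indep_var borel (x k) borel (u k)" for k
    by (rule recursion_indep_var_next[where ?x0.0 = x0, OF u_indep _ _ _ step_meas])
      (auto simp: x_0 x_Suc h B)
  have u_distr: "distr M borel (u k) = gauss_measure" for k
  proof -
    have "distr M borel (u k) = distr M lborel (u k)"
      by (rule distr_cong) auto
    then show ?thesis
      using distributed_distr_eq_density[OF u_gauss] by (simp add: gauss_measure_def)
  qed
  have step: "l / L * (\<Phi> k - f xs) \<le> \<Phi> k - \<Phi> (Suc k) + d * b + d * \<sigma> k" for k
  proof -
    have "\<Phi> (Suc k) - \<Phi> k \<le> - (l / L) * (\<Phi> k - f xs)
        + d * (L * \<bar>\<mu>\<bar> * sqrt (real CARD('n)) + \<sigma> k)"
      unfolding \<Phi>_eq d_def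
    proof (rule expected_step[OF X(2,3) xs(1) PL M indep u_distr x_in])
      show "AE \<omega> in M. (\<integral>\<omega>'. (oracle_error \<mu> (x k \<omega>) (u k \<omega>'))\<^sup>2 \<partial>M) \<le> (\<sigma> k)\<^sup>2"
        using \<sigma>[of k] by (simp add: oracle_error_def B)
      show "x (Suc k) \<in> borel_measurable M"
        by (rule indep_var_rv1[OF indep])
    qed (use x_Suc \<sigma>_nonneg in \<open>auto simp: h B\<close>)
    moreover have "L * \<bar>\<mu>\<bar> * sqrt (real CARD('n)) \<le> b"
      using mult_left_mono[OF sqrt_dim_le[of "real CARD('n)"], of "L * \<mu>"] L_pos \<mu>_pos
      by (simp add: b_def mult_ac)
    then have "d * (L * \<bar>\<mu>\<bar> * sqrt (real CARD('n)) + \<sigma> k) \<le> d * b + d * \<sigma> k"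
      unfolding distrib_left using d by (intro add_right_mono mult_left_mono)
    ultimately show ?thesis
      by linarith
  qed
  have \<Phi>_ge: "f xs \<le> \<Phi> k" for k
    unfolding \<Phi>_eq
    by (intro integral_ge_const integrable_f_compact[OF X(2) M indep_var_rv1[OF indep] x_in])
      (auto intro!: AE_I2 xs(2) x_in)
  have "l / L * (\<Sum>k=0..N. \<Phi> k - f xs)
      \<le> (\<Sum>k=0..N. \<Phi> k - \<Phi> (Suc k) + d * b + d * \<sigma> k)"
    unfolding sum_distrib_left by (intro sum_mono step)
  also have "\<dots> = \<Phi> 0 - \<Phi> (Suc N) + (real N + 1) * (d * b) + d * (\<Sum>k=0..N. \<sigma> k)"
    by (induction N) (auto simp: algebra_simps)
  also have "\<dots> \<le> f x0 - f xs + (real N + 1) * (d * b) + d * (\<Sum>k=0..N. \<sigma> k)"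
    using \<Phi>_ge[of "Suc N"] by (simp add: \<Phi>_0)
  finally have "L / (l * (real N + 1)) * (l / L * (\<Sum>k=0..N. \<Phi> k - f xs))
      \<le> L / (l * (real N + 1))
          * (f x0 - f xs + (real N + 1) * (d * b) + d * (\<Sum>k=0..N. \<sigma> k))"
    using L_pos l_pos by (intro mult_left_mono) auto
  also have "L / (l * (real N + 1)) * (l / L * (\<Sum>k=0..N. \<Phi> k - f xs))
      = 1 / (real N + 1) * (\<Sum>k=0..N. \<Phi> k - f xs)"
    using L_pos l_pos by simp
  also have "L / (l * (real N + 1))
          * (f x0 - f xs + (real N + 1) * (d * b) + d * (\<Sum>k=0..N. \<sigma> k))
      = L / l * ((f x0 - f xs) / (real N + 1)) + L / l * (d * b)
        + L * d / (l * (real N + 1)) * (\<Sum>k=0..N. \<sigma> k)"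
  proof -
    have "L / (l * n) * (A + n * D + E) = L / l * (A / n) + L / l * D + L / (l * n) * E"
      if "n > 0" for n A D E :: real
      using that by (simp add: distrib_left)
    from this[of "real N + 1"] show ?thesis
      by simp
  qed
  also have "L / l * (d * b) = \<mu> * d * L\<^sup>2 * (real CARD('n) + 3) powr (3 / 2) / (2 * l)"
    by (simp add: b_def power2_eq_square mult_ac)
  finally show ?thesis
    using l_pos sum_nonneg[of "{0..N}" "\<lambda>k. (\<sigma> k)\<^sup>2"] by (simp add: d_def add_increasing2)
qed

end
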